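(* For $n\geq1$, $$\sum_{\pi\in\mathfrak{S}_n(3142,3124)}s^{\mathrm{VID}(\pi)}t^{\mathrm{DES}(\pi)}=\sum_{e\in\mathbf{I}_n(\geq,\neq,\geq)}s^{\mathrm{DIST}(e)}t^{\mathrm{ASC}(e)}.$$
   Context: $\mathfrak{S}_n(3142,3124)$ is the set of permutations of $\{1,\ldots,n\}$ containing no subsequence of length 4 order-isomorphic to $3142$ or $3124$. $\mathrm{DES}(\pi)=\{i\in[n-1]:\pi_i>\pi_{i+1}\}$; $\mathrm{VID}(\pi)=\{2\leq i\leq n:\text{the value } \pi_i+1 \text{ appears to the left of position } i\}$. $\mathbf{I}_n=\{(e_1,\ldots,e_n): 0\leq e_i<i\}$; $\mathbf{I}_n(\geq,\neq,\geq)$ is the set of $e\in\mathbf{I}_n$ with no $i<j<k$ such that $e_i\geq e_j$, $e_j\neq e_k$ and $e_i\geq e_k$. $\mathrm{ASC}(e)=\{i\in[n-1]:e_i<e_{i+1}\}$; $\mathrm{DIST}(e)=\{2\leq i\leq n: e_i\neq0\text{ and } e_i\neq e_j\text{ for all } j>i\}$. For a set $S$ of positive integers, $s^S=\prod_{i\in S}s_i$, $t^S=\prod_{i\in S}t_i$. *)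

theory Defs
  imports "HOL-Library.FuncSet" "HOL-Combinatorics.Permutations"
begin

text \<open>
  Permutations of \<open>{1..n}\<close> are functions \<open>p\<close> with \<open>p permutes {1..n}\<close>, and a sequence
  \<open>(e\<^sub>1, \<dots>, e\<^sub>n)\<close> is an extensional function on \<open>{1..n}\<close>; positions are thus 1-based throughout.
  The entries of a pattern are listed in one-line notation.
\<close>

definition contains_pattern :: "nat \<Rightarrow> (nat \<Rightarrow> nat) \<Rightarrow> nat list \<Rightarrow> bool" where
  "contains_pattern n p \<sigma> \<longleftrightarrow>
     (\<exists>f. strict_mono_on {..<length \<sigma>} f \<and> f ` {..<length \<sigma>} \<subseteq> {1..n} \<and>
          (\<forall>a<length \<sigma>. \<forall>b<length \<sigma>. p (f a) < p (f b) \<longleftrightarrow> \<sigma> ! a < \<sigma> ! b))"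

definition avoiding_perms :: "nat \<Rightarrow> nat list set \<Rightarrow> (nat \<Rightarrow> nat) set" where
  "avoiding_perms n P = {p. p permutes {1..n} \<and> (\<forall>\<sigma>\<in>P. \<not> contains_pattern n p \<sigma>)}"

definition DES :: "nat \<Rightarrow> (nat \<Rightarrow> nat) \<Rightarrow> nat set" where
  "DES n p = {i \<in> {1..n - 1}. p i > p (i + 1)}"

definition VID :: "nat \<Rightarrow> (nat \<Rightarrow> nat) \<Rightarrow> nat set" where
  "VID n p = {i \<in> {2..n}. \<exists>j\<in>{1..<i}. p j = p i + 1}"

definition inv_seqs :: "nat \<Rightarrow> (nat \<Rightarrow> nat) set" where
  "inv_seqs n = (\<Pi>\<^sub>E i\<in>{1..n}. {0..<i})"

definition inv_seqs_avoiding ::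
    "nat \<Rightarrow> (nat \<Rightarrow> nat \<Rightarrow> bool) \<Rightarrow> (nat \<Rightarrow> nat \<Rightarrow> bool) \<Rightarrow> (nat \<Rightarrow> nat \<Rightarrow> bool) \<Rightarrow> (nat \<Rightarrow> nat) set" where
  "inv_seqs_avoiding n r1 r2 r3 =
     {e \<in> inv_seqs n. \<not> (\<exists>i\<in>{1..n}. \<exists>j\<in>{1..n}. \<exists>k\<in>{1..n}. i < j \<and> j < k \<and>
         r1 (e i) (e j) \<and> r2 (e j) (e k) \<and> r3 (e i) (e k))}"

definition ASC :: "nat \<Rightarrow> (nat \<Rightarrow> nat) \<Rightarrow> nat set" where
  "ASC n e = {i \<in> {1..n - 1}. e i < e (i + 1)}"

definition DIST :: "nat \<Rightarrow> (nat \<Rightarrow> nat) \<Rightarrow> nat set" where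
  "DIST n e = {i \<in> {2..n}. e i \<noteq> 0 \<and> (\<forall>j\<in>{i<..n}. e i \<noteq> e j)}"

end

theory Submission
  imports Defs
begin

text \<open>
  Both families are grown by appending a last entry, and both growth processes are governed by the
  same succession rule. The state of an object of length \<open>n\<close> consists of its two statistics \<open>V\<close>
  (VID or DIST) and \<open>D\<close> (DES or ASC), the number \<open>a\<close> of admissible last entries (sites) and the number
  \<open>u\<close> of those that put \<open>n\<close> into \<open>D\<close>. Let \<open>j\<close> be the least index with \<open>{j..<n} \<subseteq> D\<close>.
  \<^item> The \<open>k\<close>-th site that puts \<open>n\<close> into \<open>D\<close> adds \<open>n + 1\<close> to \<open>V\<close>; it keeps all sites, creates one more,
    and leaves \<open>k\<close> sites that put \<open>n + 1\<close> into \<open>D\<close>.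
  \<^item> Every other site leads to \<open>u + 2\<close> sites, \<open>u + 1\<close> of which put \<open>n + 1\<close> into \<open>D\<close>. Each
    \<open>i \<in> {j..n}\<close> is linked to one of them (\<open>\<pi>\<^sub>i + 1\<close>, respectively \<open>e\<^sub>i\<close>), which replaces \<open>i\<close> by
    \<open>n + 1\<close> in \<open>V\<close> if \<open>i \<in> V\<close> and leaves \<open>V\<close> unchanged otherwise; the remaining ones add \<open>n + 1\<close> to \<open>V\<close>.
\<close>

section \<open>Generating trees\<close>

text \<open>For \<open>D\<close> a descent or ascent set these are the positions of the last maximal
  monotone run. For \<open>n\<close> at least 1 the run contains \<open>n\<close>, because
  \<open>{n..<n}\<close> is empty.\<close>

definition run :: "nat \<Rightarrow> nat set \<Rightarrow> nat set" where
  "run n D = {i \<in> {1..n}. {i..<n} \<subseteq> D}"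

definition move_mark :: "nat \<Rightarrow> nat \<Rightarrow> nat set \<Rightarrow> nat set" where
  "move_mark i m V = (if i \<in> V then insert m (V - {i}) else V)"

text \<open>A transfer operator on weights: \<open>F\<close> evaluates a state, and the result
  evaluates the parent by summing \<open>F\<close> over all its children. The factor in the last
  summand counts the sites that neither lie in \<open>u\<close> nor are linked to a run position;
  their children all share one state.\<close>

definition tree_step ::
    "nat \<Rightarrow> (nat set \<Rightarrow> nat set \<Rightarrow> nat \<Rightarrow> nat \<Rightarrow> 'a::comm_semiring_1) \<Rightarrow> nat set \<Rightarrow> nat set \<Rightarrow> nat \<Rightarrow> nat \<Rightarrow> 'a" where
  "tree_step n F V D a u =
     (\<Sum>k\<in>{1..u}. F (insert (Suc n) V) (insert n D) (Suc a) k)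
     + (\<Sum>i\<in>run n D. F (move_mark i (Suc n) V) D (u + 2) (Suc u))
     + of_nat (a - u - card (run n D)) * F (insert (Suc n) V) D (u + 2) (Suc u)"

text \<open>Index \<open>n\<close> stands for objects of length \<open>n + 1\<close>.\<close>

fun tree_sum :: "nat \<Rightarrow> (nat set \<Rightarrow> nat set \<Rightarrow> nat \<Rightarrow> nat \<Rightarrow> 'a::comm_semiring_1) \<Rightarrow> 'a" where
  "tree_sum 0 F = F {} {} 2 1"
| "tree_sum (Suc n) F = tree_sum n (tree_step (Suc n) F)"

lemma finite_run: "finite (run n D)"
  by (simp add: run_def)

text \<open>The succession rule, stated for abstract objects \<open>A n\<close> with sites
  \<open>S\<close>, sites \<open>U\<close> that put \<open>n\<close> into \<open>D\<close>, and
  \<open>link\<close> sending a run position to its site. By \<open>link_in\<close> the sites in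
  \<open>U\<close> are never linked, so \<open>V_free\<close> covers them as well.
  \<open>U_U\<close> asks only that each size from 1 to \<open>card (U n x)\<close> occurs once,
  since the sizes increase with the site for one family and decrease for the other.\<close>

locale run_tree =
  fixes A :: "nat \<Rightarrow> 'x set"
    and S U :: "nat \<Rightarrow> 'x \<Rightarrow> nat set"
    and child :: "nat \<Rightarrow> 'x \<Rightarrow> nat \<Rightarrow> 'x"
    and link :: "'x \<Rightarrow> nat \<Rightarrow> nat"
    and V D :: "nat \<Rightarrow> 'x \<Rightarrow> nat set"
  assumes root: "\<exists>x. A 1 = {x} \<and> V 1 x = {} \<and> D 1 x = {} \<and> card (S 1 x) = 2 \<and> card (U 1 x) = 1"
    and child_bij: "n \<ge> 1 \<Longrightarrow> bij_betw (\<lambda>(x, c). child n x c) (SIGMA x:A n. S n x) (A (Suc n))"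
    and finite_S: "n \<ge> 1 \<Longrightarrow> x \<in> A n \<Longrightarrow> finite (S n x)"
    and U_subset: "n \<ge> 1 \<Longrightarrow> x \<in> A n \<Longrightarrow> U n x \<subseteq> S n x"
    and inj_link: "n \<ge> 1 \<Longrightarrow> x \<in> A n \<Longrightarrow> inj_on (link x) (run n (D n x))"
    and link_in: "n \<ge> 1 \<Longrightarrow> x \<in> A n \<Longrightarrow> i \<in> run n (D n x) \<Longrightarrow> link x i \<in> S n x - U n x"
    and D_U: "n \<ge> 1 \<Longrightarrow> x \<in> A n \<Longrightarrow> c \<in> U n x \<Longrightarrow> D (Suc n) (child n x c) = insert n (D n x)"
    and D_not_U: "n \<ge> 1 \<Longrightarrow> x \<in> A n \<Longrightarrow> c \<in> S n x - U n x \<Longrightarrow> D (Suc n) (child n x c) = D n x"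
    and V_free: "n \<ge> 1 \<Longrightarrow> x \<in> A n \<Longrightarrow> c \<in> S n x - link x ` run n (D n x) \<Longrightarrow>
      V (Suc n) (child n x c) = insert (Suc n) (V n x)"
    and V_link: "n \<ge> 1 \<Longrightarrow> x \<in> A n \<Longrightarrow> i \<in> run n (D n x) \<Longrightarrow>
      V (Suc n) (child n x (link x i)) = move_mark i (Suc n) (V n x)"
    and S_U: "n \<ge> 1 \<Longrightarrow> x \<in> A n \<Longrightarrow> c \<in> U n x \<Longrightarrow> card (S (Suc n) (child n x c)) = Suc (card (S n x))"
    and S_not_U: "n \<ge> 1 \<Longrightarrow> x \<in> A n \<Longrightarrow> c \<in> S n x - U n x \<Longrightarrow>
      card (S (Suc n) (child n x c)) = card (U n x) + 2"
    and U_U: "n \<ge> 1 \<Longrightarrow> x \<in> A n \<Longrightarrow>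
      bij_betw (\<lambda>c. card (U (Suc n) (child n x c))) (U n x) {1..card (U n x)}"
    and U_not_U: "n \<ge> 1 \<Longrightarrow> x \<in> A n \<Longrightarrow> c \<in> S n x - U n x \<Longrightarrow>
      card (U (Suc n) (child n x c)) = Suc (card (U n x))"
begin

lemma finite_A: "n \<ge> 1 \<Longrightarrow> finite (A n)"
proof (induction n rule: dec_induct)
  case base
  then show ?case using root by auto
next
  case (step n)
  then have "finite (SIGMA x:A n. S n x)"
    using finite_S by auto
  then show ?case
    using child_bij[OF step(1)] bij_betw_finite by blast
qed

text \<open>The sites split into \<open>U n x\<close>, the linked sites and the remaining ones;
  these three blocks yield the three summands of \<open>tree_step\<close>.\<close>

lemma sum_children:
  assumes n: "n \<ge> 1" and x: "x \<in> A n"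
  shows "(\<Sum>c\<in>S n x. F (V (Suc n) (child n x c)) (D (Suc n) (child n x c))
            (card (S (Suc n) (child n x c))) (card (U (Suc n) (child n x c))))
       = tree_step n F (V n x) (D n x) (card (S n x)) (card (U n x))"
    (is "sum ?f _ = _")
proof -
  let ?R = "run n (D n x)" and ?V = "V n x" and ?D = "D n x"
  let ?L = "link x ` ?R" and ?u = "card (U n x)"
  let ?G = "S n x - U n x - ?L"
  note fin = finite_S[OF n x]
  have finU: "finite (U n x)"
    using fin U_subset[OF n x] finite_subset by blast
  have L: "?L \<subseteq> S n x - U n x"
    using link_in[OF n x] by auto
  have "S n x = (U n x \<union> ?L) \<union> ?G"
    using L U_subset[OF n x] by auto
  then have "sum ?f (S n x) = sum ?f ((U n x \<union> ?L) \<union> ?G)"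
    by simp
  also have "\<dots> = sum ?f (U n x \<union> ?L) + sum ?f ?G"
    using fin finU finite_run by (intro sum.union_disjoint) auto
  also have "sum ?f (U n x \<union> ?L) = sum ?f (U n x) + sum ?f ?L"
    using fin finU finite_run L by (intro sum.union_disjoint) auto
  also have "sum ?f (U n x) = (\<Sum>c\<in>U n x. F (insert (Suc n) ?V) (insert n ?D) (Suc (card (S n x)))
      (card (U (Suc n) (child n x c))))"
  proof (intro sum.cong refl)
    fix c assume c: "c \<in> U n x"
    with L U_subset[OF n x] have "c \<in> S n x - ?L" by auto
    with c show "?f c = F (insert (Suc n) ?V) (insert n ?D) (Suc (card (S n x)))
      (card (U (Suc n) (child n x c)))"
      by (simp add: V_free[OF n x] D_U[OF n x] S_U[OF n x])
  qed
  also have "\<dots> = (\<Sum>k\<in>{1..?u}. F (insert (Suc n) ?V) (insert n ?D) (Suc (card (S n x))) k)"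
    using U_U[OF n x] by (rule sum.reindex_bij_betw)
  also have "sum ?f ?L = (\<Sum>i\<in>?R. ?f (link x i))"
    by (simp add: sum.reindex[OF inj_link[OF n x]])
  also have "\<dots> = (\<Sum>i\<in>?R. F (move_mark i (Suc n) ?V) ?D (?u + 2) (Suc ?u))"
    by (intro sum.cong refl)
       (simp only: V_link[OF n x] D_not_U[OF n x link_in[OF n x]]
          S_not_U[OF n x link_in[OF n x]] U_not_U[OF n x link_in[OF n x]])
  also have "sum ?f ?G = (\<Sum>c\<in>?G. F (insert (Suc n) ?V) ?D (?u + 2) (Suc ?u))"
    by (intro sum.cong refl)
       (simp add: V_free[OF n x] D_not_U[OF n x] S_not_U[OF n x] U_not_U[OF n x])
  also have "\<dots> = of_nat (card ?G) * F (insert (Suc n) ?V) ?D (?u + 2) (Suc ?u)"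
    by simp
  also have "card ?G = card (S n x) - ?u - card ?R"
    using L U_subset[OF n x] fin finU finite_run inj_link[OF n x]
    by (simp add: card_Diff_subset card_image)
  finally show ?thesis
    by (simp add: tree_step_def)
qed

text \<open>The right side does not mention the objects, so any two instances of the locale have
  equal sums. The weight stays arbitrary because the induction step trades \<open>F\<close> for
  \<open>tree_step ?m F\<close> on objects one shorter.\<close>

lemma sum_eq_tree_sum:
  "(\<Sum>x\<in>A (Suc n). F (V (Suc n) x) (D (Suc n) x) (card (S (Suc n) x)) (card (U (Suc n) x))) = tree_sum n F"
proof (induction n arbitrary: F)
  case 0
  then show ?case using root by auto
next
  case (Suc n)
  let ?m = "Suc n"
  let ?f = "\<lambda>x. F (V (Suc ?m) x) (D (Suc ?m) x) (card (S (Suc ?m) x)) (card (U (Suc ?m) x))"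
  have m: "?m \<ge> 1" by simp
  have "sum ?f (A (Suc ?m)) = (\<Sum>(x, c)\<in>(SIGMA x:A ?m. S ?m x). ?f (child ?m x c))"
    using sum.reindex_bij_betw[OF child_bij[OF m], of ?f] by (simp add: case_prod_unfold)
  also have "\<dots> = (\<Sum>x\<in>A ?m. \<Sum>c\<in>S ?m x. ?f (child ?m x c))"
    using finite_A[OF m] finite_S[OF m] by (intro sum.Sigma[symmetric]) auto
  also have "\<dots> = (\<Sum>x\<in>A ?m. tree_step ?m F (V ?m x) (D ?m x) (card (S ?m x)) (card (U ?m x)))"
    using sum_children[OF m] by (intro sum.cong refl)
  also have "\<dots> = tree_sum n (tree_step ?m F)"
    by (rule Suc.IH)
  finally show ?case by simp
qed

end

text \<open>Distinct members of a strict chain of nonempty subsets of \<open>U\<close> have distinct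
  sizes between 1 and \<open>card U\<close>, and there are \<open>card U\<close> of them. It serves
  \<open>U_U\<close>, with up-sets for sequences and down-sets for permutations.\<close>

lemma bij_betw_card_chain:
  assumes fin: "finite U"
    and W: "\<And>c. c \<in> U \<Longrightarrow> c \<in> W c \<and> W c \<subseteq> U"
    and chain: "\<And>c d. c \<in> U \<Longrightarrow> d \<in> U \<Longrightarrow> c \<noteq> d \<Longrightarrow> W c \<subset> W d \<or> W d \<subset> W c"
  shows "bij_betw (\<lambda>c. card (W c)) U {1..card U}"
proof -
  have finW: "finite (W c)" if "c \<in> U" for c
    using W[OF that] fin finite_subset by blast
  have inj: "inj_on (\<lambda>c. card (W c)) U"
  proof (rule inj_onI, rule ccontr)
    fix c d assume cd: "c \<in> U" "d \<in> U" "card (W c) = card (W d)" "c \<noteq> d"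
    have "card (W c) < card (W d) \<or> card (W d) < card (W c)"
      using chain[OF cd(1,2,4)] psubset_card_mono finW[OF cd(1)] finW[OF cd(2)] by blast
    with cd(3) show False by simp
  qed
  have "(\<lambda>c. card (W c)) ` U \<subseteq> {1..card U}"
  proof
    fix k assume "k \<in> (\<lambda>c. card (W c)) ` U"
    then obtain c where c: "c \<in> U" "k = card (W c)" by auto
    have "card (W c) \<noteq> 0" using W[OF c(1)] finW[OF c(1)] by auto
    moreover have "card (W c) \<le> card U" using W[OF c(1)] fin by (simp add: card_mono)
    ultimately show "k \<in> {1..card U}" using c by simp
  qed
  then have "(\<lambda>c. card (W c)) ` U = {1..card U}"
    using card_image[OF inj] by (intro card_subset_eq) auto
  with inj show ?thesis by (simp add: bij_betw_def)
qed

section \<open>Positions inside and before the final run\<close>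

lemma run_le: "i \<in> run n D \<Longrightarrow> 1 \<le> i \<and> i \<le> n"
  by (simp add: run_def)

lemma run_mono: "i \<in> run n D \<Longrightarrow> i \<le> k \<Longrightarrow> k \<le> n \<Longrightarrow> k \<in> run n D"
  by (auto simp: run_def)

text \<open>The witness is the greatest index below \<open>n\<close> and not below \<open>i\<close>
  that is missing from \<open>D\<close>; the run starts right after it.\<close>

lemma last_break:
  assumes "1 \<le> i" "i \<le> n" "i \<notin> run n D"
  obtains k where "i \<le> k" "k < n" "k \<notin> D" "Suc k \<in> run n D"
proof -
  let ?P = "\<lambda>k. i \<le> k \<and> k < n \<and> k \<notin> D"
  let ?k = "GREATEST k. ?P k"
  have ex: "\<exists>k. ?P k" using assms by (auto simp: run_def)
  have k: "?P ?k"
    using ex by (rule GreatestI_ex_nat[where b = n]) auto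
  have "l \<in> D" if "?k < l" "l < n" for l
  proof (rule ccontr)
    assume "l \<notin> D"
    with that k have "?P l" by auto
    then have "l \<le> ?k" by (rule Greatest_le_nat[where b = n]) auto
    with that show False by simp
  qed
  then have "Suc ?k \<in> run n D"
    using k by (auto simp: run_def)
  with k that show ?thesis by blast
qed

section \<open>Inversion sequences\<close>

definition seq_clean :: "nat \<Rightarrow> (nat \<Rightarrow> nat) \<Rightarrow> bool" where
  "seq_clean n e \<longleftrightarrow> (\<forall>i j k. 1 \<le> i \<longrightarrow> i < j \<longrightarrow> j < k \<longrightarrow> k \<le> n \<longrightarrow> e j \<le> e i \<longrightarrow> e j \<noteq> e k \<longrightarrow> e i < e k)"

text \<open>These are the values that complete no forbidden triple when they take the role of its
  last entry.\<close>

definition seq_sites :: "nat \<Rightarrow> (nat \<Rightarrow> nat) \<Rightarrow> nat set" where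
  "seq_sites n e = {c \<in> {0..n}. \<forall>i j. 1 \<le> i \<longrightarrow> i < j \<longrightarrow> j \<le> n \<longrightarrow> e j \<le> e i \<longrightarrow> e j \<noteq> c \<longrightarrow> e i < c}"

definition seq_ups :: "nat \<Rightarrow> (nat \<Rightarrow> nat) \<Rightarrow> nat set" where
  "seq_ups n e = {c \<in> seq_sites n e. e n < c}"

abbreviation seqs :: "nat \<Rightarrow> (nat \<Rightarrow> nat) set" where
  "seqs n \<equiv> inv_seqs_avoiding n (\<ge>) (\<noteq>) (\<ge>)"

lemma mem_seqs: "e \<in> seqs n \<longleftrightarrow> e \<in> inv_seqs n \<and> seq_clean n e"
proof -
  have "(\<exists>i\<in>{1..n}. \<exists>j\<in>{1..n}. \<exists>k\<in>{1..n}. i < j \<and> j < k \<and> e i \<ge> e j \<and> e j \<noteq> e k \<and> e i \<ge> e k)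
      \<longleftrightarrow> \<not> seq_clean n e" (is "?L \<longleftrightarrow> _")
  proof
    assume ?L
    then show "\<not> seq_clean n e"
      unfolding seq_clean_def by (meson atLeastAtMost_iff not_le)
  next
    assume "\<not> seq_clean n e"
    then obtain i j k where "1 \<le> i" "i < j" "j < k" "k \<le> n" "e j \<le> e i" "e j \<noteq> e k" "\<not> e i < e k"
      unfolding seq_clean_def by blast
    moreover from this have "i \<in> {1..n}" "j \<in> {1..n}" "k \<in> {1..n}" by auto
    ultimately show ?L by (meson not_le)
  qed
  then show ?thesis unfolding inv_seqs_avoiding_def by blast
qed

text \<open>A triple that involves the new position must have it as its last index.\<close>

lemma seq_clean_Suc:
  "seq_clean (Suc n) (e(Suc n := c)) \<longleftrightarrow>
     seq_clean n e \<and> (\<forall>i j. 1 \<le> i \<longrightarrow> i < j \<longrightarrow> j \<le> n \<longrightarrow> e j \<le> e i \<longrightarrow> e j \<noteq> c \<longrightarrow> e i < c)"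
    (is "?L \<longleftrightarrow> ?R")
proof
  assume L: ?L
  have "e i < e k" if "1 \<le> i" "i < j" "j < k" "k \<le> n" "e j \<le> e i" "e j \<noteq> e k" for i j k
    using L[unfolded seq_clean_def, rule_format, of i j k] that by simp
  moreover have "e i < c" if "1 \<le> i" "i < j" "j \<le> n" "e j \<le> e i" "e j \<noteq> c" for i j
    using L[unfolded seq_clean_def, rule_format, of i j "Suc n"] that by simp
  ultimately show ?R unfolding seq_clean_def by blast
next
  assume ?R
  then show ?L unfolding seq_clean_def by (auto simp: le_Suc_eq)
qed

lemma inv_seqs_Suc: "e \<in> inv_seqs n \<Longrightarrow> c \<le> n \<Longrightarrow> e(Suc n := c) \<in> inv_seqs (Suc n)"
  by (auto simp: inv_seqs_def PiE_iff extensional_def)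

lemma seqs_lt: "e \<in> seqs n \<Longrightarrow> 1 \<le> i \<Longrightarrow> i \<le> n \<Longrightarrow> e i < i"
  by (auto simp: mem_seqs inv_seqs_def PiE_iff)

lemma seqs_child_bij:
  "bij_betw (\<lambda>(e, c). e(Suc n := c)) (SIGMA e:seqs n. seq_sites n e) (seqs (Suc n))"
\<comment> \<open>The inverse cuts off the last entry; \<open>restrict\<close> makes the shorter
  sequence extensional on \<open>{1..n}\<close> again.\<close>
proof (rule bij_betw_byWitness[where f' = "\<lambda>e. (restrict e {1..n}, e (Suc n))"])
  show "\<forall>a\<in>SIGMA e:seqs n. seq_sites n e. (restrict ((\<lambda>(e, c). e(Suc n := c)) a) {1..n}, (\<lambda>(e, c). e(Suc n := c)) a (Suc n)) = a"
    by (auto simp: mem_seqs inv_seqs_def PiE_iff extensional_def fun_eq_iff)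
  show "\<forall>a'\<in>seqs (Suc n). (\<lambda>(e, c). e(Suc n := c)) (restrict a' {1..n}, a' (Suc n)) = a'"
    by (auto simp: mem_seqs inv_seqs_def PiE_iff extensional_def fun_eq_iff)
  show "(\<lambda>(e, c). e(Suc n := c)) ` (SIGMA e:seqs n. seq_sites n e) \<subseteq> seqs (Suc n)"
    by (auto simp: mem_seqs seq_clean_Suc inv_seqs_Suc seq_sites_def)
  show "(\<lambda>e. (restrict e {1..n}, e (Suc n))) ` seqs (Suc n) \<subseteq> (SIGMA e:seqs n. seq_sites n e)"
  proof clarify
    fix e assume e: "e \<in> seqs (Suc n)"
    let ?e = "restrict e {1..n}"
    have "?e(Suc n := e (Suc n)) = e"
      using e by (auto simp: mem_seqs inv_seqs_def PiE_iff extensional_def fun_eq_iff)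
    then have c: "seq_clean (Suc n) (?e(Suc n := e (Suc n)))"
      using e by (simp add: mem_seqs)
    have "?e \<in> inv_seqs n"
      using e by (auto simp: mem_seqs inv_seqs_def PiE_iff)
    moreover have "e (Suc n) \<le> n"
      using seqs_lt[OF e, of "Suc n"] by simp
    ultimately show "?e \<in> seqs n \<and> e (Suc n) \<in> seq_sites n ?e"
      using c unfolding seq_clean_Suc seq_sites_def mem_seqs by simp
  qed
qed

text \<open>Either \<open>e i < e n < c\<close>, or \<open>e n \<le> e i\<close> and the site
  condition for the pair \<open>i\<close>, \<open>n\<close> forces \<open>e i < c\<close>.\<close>

lemma seq_ups_record:
  assumes "c \<in> seq_ups n e" "1 \<le> i" "i \<le> n"
  shows "e i < c"
proof (cases "i = n")
  case False
  with assms have "i < n" by simp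
  with assms have "e n \<le> e i \<longrightarrow> e n \<noteq> c \<longrightarrow> e i < c" "e n < c"
    unfolding seq_ups_def seq_sites_def by blast+
  then show ?thesis by linarith
qed (use assms in \<open>simp add: seq_ups_def\<close>)

text \<open>All run entries after the first are strict left-to-right maxima. The predecessor
  \<open>m\<close> of \<open>k\<close> is an ascent; if an earlier entry were at least
  \<open>e m\<close>, avoidance with middle index \<open>m\<close> puts it below
  \<open>e k\<close>.\<close>

lemma run_record:
  assumes "seq_clean n e" "i \<in> run n (ASC n e)" "i < k" "k \<le> n" "1 \<le> l" "l < k"
  shows "e l < e k"
proof -
  obtain m where m: "k = Suc m" using assms(3) by (cases k) auto
  have "m \<in> ASC n e" using assms m by (auto simp: run_def)
  then have "e m < e k" using m by (simp add: ASC_def)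
  moreover have "e m \<le> e l \<longrightarrow> e m \<noteq> e k \<longrightarrow> e l < e k" if "l < m"
    using assms(1,4,5) that m unfolding seq_clean_def by blast
  ultimately show ?thesis
    using assms(6) m by (cases "l = m") auto
qed

text \<open>As \<open>c\<close> exceeds every earlier entry, no pair ending at the new position
  restricts the sites. The value \<open>Suc n\<close> is new and exceeds all old entries.\<close>

lemma seq_sites_up:
  assumes "e \<in> seqs n" "c \<in> seq_ups n e"
  shows "seq_sites (Suc n) (e(Suc n := c)) = insert (Suc n) (seq_sites n e)"
proof -
  have lt: "\<And>i. 1 \<le> i \<Longrightarrow> i \<le> n \<Longrightarrow> e i < c" "\<And>i. 1 \<le> i \<Longrightarrow> i \<le> n \<Longrightarrow> e i < Suc n"
    using seq_ups_record[OF assms(2)] seqs_lt[OF assms(1)] by force+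
  show ?thesis
    unfolding seq_sites_def using lt
    by (auto simp: le_Suc_eq not_le[symmetric])
qed

text \<open>Now \<open>c \<le> e n\<close>, so the pair formed by \<open>n\<close> and the new
  position forces every site other than \<open>c\<close> above \<open>e n\<close>.\<close>

lemma seq_sites_flat:
  assumes "n \<ge> 1" "e \<in> seqs n" "c \<in> seq_sites n e - seq_ups n e"
  shows "seq_sites (Suc n) (e(Suc n := c)) = insert (Suc n) (insert c (seq_ups n e))"
proof (intro set_eqI iffI)
  have lt: "\<And>i. 1 \<le> i \<Longrightarrow> i \<le> n \<Longrightarrow> e i < Suc n"
    using seqs_lt[OF assms(2)] by force
  have c: "c \<le> e n" using assms(3) by (auto simp: seq_ups_def)
  fix y
  {
    assume y: "y \<in> seq_sites (Suc n) (e(Suc n := c))"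
    then have "y \<noteq> c \<Longrightarrow> e n < y"
      using c assms(1) unfolding seq_sites_def by fastforce
    moreover have "y = Suc n \<or> y \<in> seq_sites n e"
      using y unfolding seq_sites_def by (auto simp: le_Suc_eq)
    ultimately show "y \<in> insert (Suc n) (insert c (seq_ups n e))"
      by (auto simp: seq_ups_def)
  }
  assume y: "y \<in> insert (Suc n) (insert c (seq_ups n e))"
  then consider "y = Suc n" | "y = c" | "y \<in> seq_ups n e" by auto
  then show "y \<in> seq_sites (Suc n) (e(Suc n := c))"
  proof cases
    case 1
    then show ?thesis using lt unfolding seq_sites_def by (auto simp: le_Suc_eq)
  next
    case 2
    then show ?thesis using assms(3) unfolding seq_sites_def by (auto simp: le_Suc_eq)
  next
    case 3
    then show ?thesis
      using seq_ups_record[OF 3] unfolding seq_sites_def seq_ups_def by (auto simp: le_Suc_eq)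
  qed
qed

text \<open>A pair obstructing a repetition of \<open>e i\<close> cannot end after \<open>i\<close>,
  where all entries are records. If it ends before \<open>i\<close>, then \<open>i\<close> itself as
  third index settles it by avoidance.\<close>

lemma seq_sites_run:
  assumes "e \<in> seqs n" "i \<in> run n (ASC n e)"
  shows "e i \<in> seq_sites n e" "e i \<le> e n"
proof -
  have c: "seq_clean n e" using assms by (simp add: mem_seqs)
  note i = run_le[OF assms(2)]
  have "e k < e i"
    if kl: "1 \<le> k" "k < l" "l \<le> n" "e l \<le> e k" "e l \<noteq> e i" for k l
  proof -
    have "\<not> i < l"
      using run_record[OF c assms(2), of l k] kl by auto
    with kl(5) have "l < i" by (metis nat_neq_iff)
    then show ?thesis using c kl i unfolding seq_clean_def by blast
  qed
  moreover have "e i \<le> n" using seqs_lt[OF assms(1), of i] i by simp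
  ultimately show "e i \<in> seq_sites n e"
    by (auto simp: seq_sites_def)
  show "e i \<le> e n"
    using run_record[OF c assms(2), of n i] i by (cases "i = n") auto
qed

text \<open>Unlinked sites are new values. If \<open>c = e i\<close> with \<open>i\<close> before
  the run, the last break \<open>k\<close> gives \<open>e (Suc k) \<le> e k\<close>, and the site
  condition for this pair yields \<open>e k < c\<close>. Then the pair \<open>i\<close>,
  \<open>Suc k\<close> demands \<open>c < c\<close>.\<close>

lemma seq_sites_free:
  assumes "e \<in> seqs n" "c \<in> seq_sites n e" "c \<notin> e ` run n (ASC n e)" "1 \<le> i" "i \<le> n"
  shows "e i \<noteq> c"
proof
  assume ic: "e i = c"
  with assms have "i \<notin> run n (ASC n e)" by auto
  then obtain k where k: "i \<le> k" "k < n" "k \<notin> ASC n e" "Suc k \<in> run n (ASC n e)"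
    using last_break assms by metis
  have "e (Suc k) \<le> e k"
    using k assms(4) by (auto simp: ASC_def)
  moreover have "e (Suc k) \<noteq> c" using k assms(3) by auto
  moreover have site: "\<And>i j. 1 \<le> i \<Longrightarrow> i < j \<Longrightarrow> j \<le> n \<Longrightarrow> e j \<le> e i \<Longrightarrow> e j \<noteq> c \<Longrightarrow> e i < c"
    using assms(2) by (auto simp: seq_sites_def)
  ultimately show False
    using site[of k "Suc k"] site[of i "Suc k"] k ic assms(4) by auto
qed

section \<open>Statistics and site counts of extended sequences\<close>

lemma DIST_Suc:
  assumes "n \<ge> 1"
  shows "DIST (Suc n) (e(Suc n := c)) = {i \<in> DIST n e. e i \<noteq> c} \<union> (if c = 0 then {} else {Suc n})"
proof (rule set_eqI)
  fix i
  consider "i < 2 \<or> Suc n < i" | "2 \<le> i" "i \<le> n" | "i = Suc n" by linarith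
  then show "i \<in> DIST (Suc n) (e(Suc n := c)) \<longleftrightarrow>
      i \<in> {i \<in> DIST n e. e i \<noteq> c} \<union> (if c = 0 then {} else {Suc n})"
  proof cases
    case 1
    then have "i \<notin> {2..Suc n}" "i \<notin> {2..n}" "i \<noteq> Suc n" using assms by auto
    then show ?thesis by (simp add: DIST_def del: atLeastAtMost_iff)
  next
    case 2
    then have "{i<..Suc n} = insert (Suc n) {i<..n}" by auto
    moreover have "(\<forall>j\<in>{i<..n}. e i \<noteq> (e(Suc n := c)) j) \<longleftrightarrow> (\<forall>j\<in>{i<..n}. e i \<noteq> e j)"
      by (intro ball_cong) auto
    ultimately show ?thesis using 2 unfolding DIST_def by (simp del: fun_upd_apply) auto
  next
    case 3
    then show ?thesis using assms by (simp add: DIST_def)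
  qed
qed

lemma ASC_Suc:
  "n \<ge> 1 \<Longrightarrow> ASC (Suc n) (e(Suc n := c)) = ASC n e \<union> (if e n < c then {n} else {})"
  unfolding ASC_def by (auto simp: le_Suc_eq)

lemma finite_seq_sites: "finite (seq_sites n e)"
  by (simp add: seq_sites_def)

lemma finite_seq_ups: "finite (seq_ups n e)"
  by (simp add: seq_ups_def finite_seq_sites)

lemma seq_sites_le: "c \<in> seq_sites n e \<Longrightarrow> c \<le> n"
  by (simp add: seq_sites_def)

text \<open>The sites above the new last entry \<open>c\<close> are the old ones beyond
  \<open>c\<close> together with \<open>Suc n\<close>, which makes up for the loss of
  \<open>c\<close> in the count.\<close>

lemma seq_ups_up:
  assumes "e \<in> seqs n" "c \<in> seq_ups n e"
  shows "card (seq_ups (Suc n) (e(Suc n := c))) = card {y \<in> seq_ups n e. c \<le> y}"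
proof -
  have "c \<le> n" using assms by (auto simp: seq_ups_def seq_sites_def)
  moreover have "e n < c" using assms by (simp add: seq_ups_def)
  ultimately have "seq_ups (Suc n) (e(Suc n := c)) = insert (Suc n) ({y \<in> seq_ups n e. c \<le> y} - {c})"
    unfolding seq_ups_def seq_sites_up[OF assms] by auto
  moreover have "Suc n \<notin> seq_ups n e" by (auto simp: seq_ups_def seq_sites_def)
  moreover have "card {y \<in> seq_ups n e. c \<le> y} = Suc (card ({y \<in> seq_ups n e. c \<le> y} - {c}))"
    using assms finite_seq_ups[of n e] by (intro card.remove) auto
  ultimately show ?thesis
    using finite_seq_ups[of n e] by simp
qed

interpretation seq_tree: run_tree seqs seq_sites seq_ups "\<lambda>n e c. e(Suc n := c)" "\<lambda>e. e" DIST ASC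
proof (unfold_locales, goal_cases)
  case 1
  let ?x = "\<lambda>i. if i = 1 then 0 else undefined :: nat"
  have "e = ?x" if "e \<in> inv_seqs 1" for e
  proof
    fix i
    show "e i = ?x i"
      using that by (cases "i = 1") (simp_all add: inv_seqs_def PiE_iff extensional_def)
  qed
  moreover have "?x \<in> inv_seqs 1"
    by (simp add: inv_seqs_def PiE_iff extensional_def)
  ultimately have "inv_seqs 1 = {?x}" by blast
  moreover have "seq_clean 1 e" for e
    by (simp add: seq_clean_def)
  ultimately have "seqs 1 = {?x}"
    by (simp only: set_eq_iff mem_seqs) simp
  moreover have s: "seq_sites 1 ?x = {0, 1}"
    by (auto simp: seq_sites_def)
  moreover have "seq_ups 1 ?x = {1}"
    unfolding seq_ups_def s by auto
  ultimately show ?case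
    by (intro exI[of _ ?x]) (auto simp: DIST_def ASC_def)
next
  case (2 n)
  show ?case by (rule seqs_child_bij)
next
  case (3 n x)
  then show ?case by (simp add: finite_seq_sites)
next
  case (4 n x)
  then show ?case by (auto simp: seq_ups_def)
next
  case (5 n e)
  then have c: "seq_clean n e" by (simp add: mem_seqs)
  show ?case
  proof (rule linorder_inj_onI)
    fix i k assume "i < k" "i \<in> run n (ASC n e)" "k \<in> run n (ASC n e)"
    then show "e i \<noteq> e k"
      using run_record[OF c, of i k i] run_le by (metis nat_neq_iff)
  qed auto
next
  case (6 n e i)
  then show ?case using seq_sites_run[OF 6(2,3)] by (simp add: seq_ups_def)
next
  case (7 n e c)
  then show ?case unfolding ASC_Suc[OF 7(1)] by (auto simp: seq_ups_def)
next
  case (8 n e c)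
  then show ?case unfolding ASC_Suc[OF 8(1)] by (auto simp: seq_ups_def)
next
  case (9 n e c)
  then have ne: "e i \<noteq> c" if "1 \<le> i" "i \<le> n" for i
    using seq_sites_free that by auto
  \<comment> \<open>The value 0 occurs at position 1, so a new value is nonzero: the last position
    joins \<open>DIST\<close> and no older mark is lost.\<close>
  have "e 1 = 0" using seqs_lt[OF 9(2), of 1] 9 by simp
  then have "c \<noteq> 0" using ne[of 1] 9(1) by auto
  moreover have "{i \<in> DIST n e. e i \<noteq> c} = DIST n e"
    using ne[OF order.trans[of 1 2]] by (force simp: DIST_def)
  ultimately show ?case unfolding DIST_Suc[OF 9(1)] by simp
next
  case (10 n e i)
  then have c: "seq_clean n e" by (simp add: mem_seqs)
  have e1: "e 1 = 0" using seqs_lt[OF 10(2), of 1] 10 by simp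
  note i = run_le[OF 10(3)]
  have later: "e i < e k" if "i < k" "k \<le> n" for k
    using run_record[OF c 10(3), of k i] that i by auto
  \<comment> \<open>All entries after a run position are larger, so \<open>e i\<close> is its own
    last occurrence and only 0 can keep \<open>i\<close> out of \<open>DIST\<close>. In that case
    the appended copy is 0 too and earns no mark.\<close>
  have mem: "i \<in> DIST n e \<longleftrightarrow> e i \<noteq> 0"
  proof (cases "i = 1")
    case True
    then show ?thesis using e1 by (simp add: DIST_def)
  next
    case False
    then show ?thesis using i later by (fastforce simp: DIST_def)
  qed
  have "{k \<in> DIST n e. e k \<noteq> e i} = DIST n e - {i}"
  proof -
    have "k = i" if "k \<in> DIST n e" "e k = e i" for k
      using that i later[of k] by (cases k i rule: linorder_cases) (auto simp: DIST_def)
    then show ?thesis by blast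
  qed
  with mem show ?case unfolding DIST_Suc[OF 10(1)] by (auto simp: move_mark_def)
next
  case (11 n e c)
  have "Suc n \<notin> seq_sites n e"
    using seq_sites_le[of "Suc n" n e] by auto
  then show ?case
    unfolding seq_sites_up[OF 11(2,3)] by (simp add: finite_seq_sites)
next
  case (12 n e c)
  then have "c \<notin> seq_ups n e" "Suc n \<notin> insert c (seq_ups n e)"
    using seq_sites_le[of "Suc n" n e] by (auto simp: seq_ups_def)
  then show ?case unfolding seq_sites_flat[OF 12] by (simp add: finite_seq_ups)
next
  case (13 n e)
  have "bij_betw (\<lambda>c. card {y \<in> seq_ups n e. c \<le> y}) (seq_ups n e) {1..card (seq_ups n e)}"
  proof (rule bij_betw_card_chain[OF finite_seq_ups])
    fix c d assume cd: "c \<in> seq_ups n e" "d \<in> seq_ups n e" "c \<noteq> d"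
    have "{y \<in> seq_ups n e. b \<le> y} \<subset> {y \<in> seq_ups n e. a \<le> y}" if "a \<in> seq_ups n e" "a < b" for a b
      using that by (intro psubsetI) (auto simp: set_eq_iff not_le[symmetric])
    with cd show "{y \<in> seq_ups n e. c \<le> y} \<subset> {y \<in> seq_ups n e. d \<le> y} \<or>
        {y \<in> seq_ups n e. d \<le> y} \<subset> {y \<in> seq_ups n e. c \<le> y}"
      by (meson linorder_neqE_nat)
  qed auto
  moreover have "bij_betw (\<lambda>c. card (seq_ups (Suc n) (e(Suc n := c)))) (seq_ups n e) B \<longleftrightarrow>
      bij_betw (\<lambda>c. card {y \<in> seq_ups n e. c \<le> y}) (seq_ups n e) B" for B
    by (intro bij_betw_cong seq_ups_up[OF 13(2)])
  ultimately show ?case by simp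
next
  case (14 n e c)
  then have "c \<le> e n" "c \<le> n" "Suc n \<notin> seq_ups n e"
    using seq_sites_le[of c n e] seq_sites_le[of "Suc n" n e] by (auto simp: seq_ups_def)
  \<comment> \<open>The new last entry lies weakly below the old one, so all former ascending sites
    remain ascending and \<open>Suc n\<close> joins them.\<close>
  moreover have "c < y" if "y \<in> seq_ups n e" for y
    using that \<open>c \<le> e n\<close> by (auto simp: seq_ups_def)
  ultimately have "seq_ups (Suc n) (e(Suc n := c)) = insert (Suc n) (seq_ups n e)"
    unfolding seq_ups_def[of "Suc n"] seq_sites_flat[OF 14] by auto
  then show ?case using \<open>Suc n \<notin> _\<close> by (simp add: finite_seq_ups)
qed

section \<open>Permutations\<close>

text \<open>The patterns 3142 and 3124 differ only in the order of the two entries that follow the inversion.\<close>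

definition perm_clean :: "nat \<Rightarrow> (nat \<Rightarrow> nat) \<Rightarrow> bool" where
  "perm_clean n p \<longleftrightarrow> (\<forall>i j k l. 1 \<le> i \<longrightarrow> i < j \<longrightarrow> j < k \<longrightarrow> j < l \<longrightarrow> k \<le> n \<longrightarrow> l \<le> n \<longrightarrow>
     \<not> (p j < p k \<and> p k < p i \<and> p i < p l))"

text \<open>The two clauses let the appended value \<open>x\<close> play the 2 of 3142 and the 4 of
  3124. The comparison \<open>x \<le> p i\<close> is weak because an old value equal to
  \<open>x\<close> is raised above it.\<close>

definition perm_site :: "nat \<Rightarrow> (nat \<Rightarrow> nat) \<Rightarrow> nat \<Rightarrow> bool" where
  "perm_site n p x \<longleftrightarrow> (\<forall>i j k. 1 \<le> i \<longrightarrow> i < j \<longrightarrow> j < k \<longrightarrow> k \<le> n \<longrightarrow>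
     \<not> (p j < x \<and> x \<le> p i \<and> p i < p k) \<and> \<not> (p j < p k \<and> p k < p i \<and> p i < x))"

definition perm_sites :: "nat \<Rightarrow> (nat \<Rightarrow> nat) \<Rightarrow> nat set" where
  "perm_sites n p = {x \<in> {1..Suc n}. perm_site n p x}"

definition perm_downs :: "nat \<Rightarrow> (nat \<Rightarrow> nat) \<Rightarrow> nat set" where
  "perm_downs n p = {x \<in> perm_sites n p. x \<le> p n}"

text \<open>Old values from \<open>x\<close> upwards are raised by one to make room for the new last value \<open>x\<close>.\<close>

definition append_value :: "nat \<Rightarrow> (nat \<Rightarrow> nat) \<Rightarrow> nat \<Rightarrow> nat \<Rightarrow> nat" where
  "append_value n p x i =
     (if i = Suc n then x else if i \<in> {1..n} then (if x \<le> p i then Suc (p i) else p i) else i)"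

definition delete_last :: "nat \<Rightarrow> (nat \<Rightarrow> nat) \<Rightarrow> nat \<Rightarrow> nat" where
  "delete_last n q i = (if i \<in> {1..n} then (if q (Suc n) < q i then q i - 1 else q i) else i)"

definition perms :: "nat \<Rightarrow> (nat \<Rightarrow> nat) set" where
  "perms n = avoiding_perms n {[3,1,4,2], [3,1,2,4]}"

section \<open>The two patterns as conditions on four indices\<close>

lemma contains_pattern_4:
  assumes "length \<sigma> = 4"
  shows "contains_pattern n p \<sigma> \<longleftrightarrow>
    (\<exists>i j k l. 1 \<le> i \<and> i < j \<and> j < k \<and> k < l \<and> l \<le> n \<and>
      (\<forall>a<4. \<forall>b<4. p ([i, j, k, l] ! a) < p ([i, j, k, l] ! b) \<longleftrightarrow> \<sigma> ! a < \<sigma> ! b))"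
    (is "?L \<longleftrightarrow> ?R")
proof
  assume ?L
  then obtain f where f: "strict_mono_on {..<4} f" "f ` {..<4} \<subseteq> {1..n}"
      "\<forall>a<4. \<forall>b<4. p (f a) < p (f b) \<longleftrightarrow> \<sigma> ! a < \<sigma> ! b"
    using assms by (auto simp: contains_pattern_def)
  have lt: "f 0 < f 1" "f 1 < f 2" "f 2 < f 3"
    using f(1) by (auto intro: strict_mono_onD)
  have "f 0 \<in> {1..n}" "f 3 \<in> {1..n}"
    using f(2) by (auto simp: image_subset_iff)
  moreover have "[f 0, f 1, f 2, f 3] ! a = f a" if "a < 4" for a :: nat
  proof -
    have "a = 0 \<or> a = 1 \<or> a = 2 \<or> a = 3" using that by auto
    then show ?thesis by (auto simp: numeral_2_eq_2 numeral_3_eq_3)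
  qed
  ultimately show ?R
    using lt f(3) by (intro exI[of _ "f 0"] exI[of _ "f 1"] exI[of _ "f 2"] exI[of _ "f 3"]) auto
next
  assume ?R
  then obtain i j k l where ijkl: "1 \<le> i" "i < j" "j < k" "k < l" "l \<le> n"
      "\<forall>a<4. \<forall>b<4. p ([i, j, k, l] ! a) < p ([i, j, k, l] ! b) \<longleftrightarrow> \<sigma> ! a < \<sigma> ! b"
    by blast
  let ?f = "\<lambda>a. [i, j, k, l] ! a"
  have four: "{..<4::nat} = {0, 1, 2, 3}" by auto
  have "strict_mono_on {..<4} ?f"
    using ijkl by (auto simp: four strict_mono_on_def numeral_2_eq_2 numeral_3_eq_3)
  moreover have "?f ` {..<4} \<subseteq> {1..n}"
    using ijkl by (auto simp: four numeral_2_eq_2 numeral_3_eq_3)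
  ultimately show ?L
    using ijkl(6) assms unfolding contains_pattern_def by (intro exI[of _ ?f]) simp
qed

text \<open>The indices are written with \<open>Suc\<close> so that list lookups evaluate by
  simplification.\<close>

lemma all_less_4: "(\<forall>a<4. P a) \<longleftrightarrow> P 0 \<and> P (Suc 0) \<and> P (Suc (Suc 0)) \<and> P (Suc (Suc (Suc 0)))"
  for P :: "nat \<Rightarrow> bool"
  by (auto simp: numeral_eq_Suc less_Suc_eq)

lemma contains_3142:
  "contains_pattern n p [3,1,4,2] \<longleftrightarrow>
    (\<exists>i j k l. 1 \<le> i \<and> i < j \<and> j < k \<and> k < l \<and> l \<le> n \<and> p j < p l \<and> p l < p i \<and> p i < p k)"
proof -
  have "(\<forall>a<4. \<forall>b<4. p ([i, j, k, l] ! a) < p ([i, j, k, l] ! b) \<longleftrightarrow>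
      [3,1,4,2::nat] ! a < [3,1,4,2] ! b) \<longleftrightarrow> p j < p l \<and> p l < p i \<and> p i < p k" for i j k l
    by (simp only: all_less_4) auto
  then show ?thesis by (simp add: contains_pattern_4)
qed

lemma contains_3124:
  "contains_pattern n p [3,1,2,4] \<longleftrightarrow>
    (\<exists>i j k l. 1 \<le> i \<and> i < j \<and> j < k \<and> k < l \<and> l \<le> n \<and> p j < p k \<and> p k < p i \<and> p i < p l)"
proof -
  have "(\<forall>a<4. \<forall>b<4. p ([i, j, k, l] ! a) < p ([i, j, k, l] ! b) \<longleftrightarrow>
      [3,1,2,4::nat] ! a < [3,1,2,4] ! b) \<longleftrightarrow> p j < p k \<and> p k < p i \<and> p i < p l" for i j k l
    by (simp only: all_less_4) auto
  then show ?thesis by (simp add: contains_pattern_4)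
qed

text \<open>In \<open>perm_clean\<close>, \<open>k < l\<close> gives 3124 and \<open>l < k\<close>
  gives 3142; \<open>k = l\<close> is impossible since \<open>p k < p i < p l\<close>.\<close>

lemma mem_perms: "p \<in> perms n \<longleftrightarrow> p permutes {1..n} \<and> perm_clean n p"
proof -
  have "perm_clean n p \<longleftrightarrow> \<not> contains_pattern n p [3,1,4,2] \<and> \<not> contains_pattern n p [3,1,2,4]"
    (is "_ \<longleftrightarrow> ?R")
  proof
    assume "perm_clean n p"
    then show ?R
      unfolding contains_3142 contains_3124 perm_clean_def
      by (meson less_trans less_le_trans less_imp_le)
  next
    assume R: ?R
    show "perm_clean n p"
      unfolding perm_clean_def
    proof (intro allI impI notI)
      fix i j k l
      assume *: "1 \<le> i" "i < j" "j < k" "j < l" "k \<le> n" "l \<le> n" "p j < p k \<and> p k < p i \<and> p i < p l"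
      consider "k < l" | "l < k" | "k = l" by linarith
      then show False
      proof cases
        case 1
        with * R show False unfolding contains_3124 by blast
      next
        case 2
        with * R show False unfolding contains_3142 by blast
      qed (use * in auto)
    qed
  qed
  then show ?thesis by (simp add: perms_def avoiding_perms_def)
qed

section \<open>Inserting and deleting a last value\<close>

lemma append_value_last [simp]: "append_value n p x (Suc n) = x"
  by (simp add: append_value_def)

lemma append_value_le: "1 \<le> i \<Longrightarrow> i \<le> n \<Longrightarrow> append_value n p x i = (if x \<le> p i then Suc (p i) else p i)"
  by (simp add: append_value_def)

lemma append_value_less_iff:
  assumes "1 \<le> i" "i \<le> n" "1 \<le> j" "j \<le> n"
  shows "append_value n p x i < append_value n p x j \<longleftrightarrow> p i < p j"
  using assms by (simp add: append_value_le)

lemma append_value_vs_last: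
  assumes "1 \<le> i" "i \<le> n"
  shows "append_value n p x i < x \<longleftrightarrow> p i < x" "x < append_value n p x i \<longleftrightarrow> x \<le> p i"
  using assms by (auto simp: append_value_le)

text \<open>The new position is the largest, so it can only be \<open>k\<close> or \<open>l\<close>
  in an occurrence; these two cases are the two clauses of \<open>perm_site\<close>.\<close>

lemma perm_clean_append_value:
  "perm_clean (Suc n) (append_value n p x) \<longleftrightarrow> perm_clean n p \<and> perm_site n p x"
  (is "?L \<longleftrightarrow> ?R")
proof
  assume L: ?L
  have "\<not> (p j < p k \<and> p k < p i \<and> p i < p l)"
    if "1 \<le> i" "i < j" "j < k" "j < l" "k \<le> n" "l \<le> n" for i j k l
    using L[unfolded perm_clean_def, rule_format, of i j k l] that by (simp add: append_value_less_iff)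
  moreover have "\<not> (p j < x \<and> x \<le> p i \<and> p i < p k)" "\<not> (p j < p k \<and> p k < p i \<and> p i < x)"
    if "1 \<le> i" "i < j" "j < k" "k \<le> n" for i j k
    using L[unfolded perm_clean_def, rule_format, of i j "Suc n" k]
      L[unfolded perm_clean_def, rule_format, of i j k "Suc n"] that
    by (simp_all add: append_value_less_iff append_value_vs_last)
  ultimately show ?R unfolding perm_clean_def perm_site_def by blast
next
  let ?q = "append_value n p x"
  assume R: ?R
  show ?L
    unfolding perm_clean_def
  proof (intro allI impI)
    fix i j k l
    assume *: "1 \<le> i" "i < j" "j < k" "j < l" "k \<le> Suc n" "l \<le> Suc n"
    consider "k \<le> n" "l \<le> n" | "k = Suc n" "l \<le> n" | "k \<le> n" "l = Suc n" | "k = Suc n" "l = Suc n"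
      using * by linarith
    then show "\<not> (?q j < ?q k \<and> ?q k < ?q i \<and> ?q i < ?q l)"
    proof cases
      case 1
      moreover have "\<not> (p j < p k \<and> p k < p i \<and> p i < p l)"
        using R * 1 unfolding perm_clean_def by blast
      ultimately show ?thesis using * by (simp add: append_value_less_iff)
    next
      case 2
      moreover have "\<not> (p j < x \<and> x \<le> p i \<and> p i < p l)"
        using R * 2 unfolding perm_site_def by blast
      ultimately show ?thesis using * by (simp add: append_value_less_iff append_value_vs_last)
    next
      case 3
      moreover have "\<not> (p j < p k \<and> p k < p i \<and> p i < x)"
        using R * 3 unfolding perm_site_def by blast
      ultimately show ?thesis using * by (simp add: append_value_less_iff append_value_vs_last)
    qed simp
  qed
qed

lemma permutesI_inj:
  assumes "finite A" "inj_on p A" "p ` A \<subseteq> A" "\<And>i. i \<notin> A \<Longrightarrow> p i = i"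
  shows "p permutes A"
  using assms endo_inj_surj[of A p] by (intro bij_imp_permutes) (auto simp: bij_betw_def)

lemma permutes_interval:
  assumes "p permutes {1..n}" "1 \<le> i" "i \<le> n"
  shows "1 \<le> p i" "p i \<le> n"
  using permutes_in_image[OF assms(1), of i] assms(2,3) by auto

lemma permutes_value:
  assumes "p permutes {1..n}" "1 \<le> v" "v \<le> n"
  obtains i where "1 \<le> i" "i \<le> n" "p i = v"
proof -
  have "v \<in> p ` {1..n}" using assms by (simp add: permutes_image)
  with that show ?thesis by auto
qed

lemma permutes_eq_iff: "p permutes A \<Longrightarrow> p i = p j \<longleftrightarrow> i = j"
  by (meson permutes_inj inj_eq)

lemma append_value_permutes:
  assumes "p permutes {1..n}" "1 \<le> x" "x \<le> Suc n"
  shows "append_value n p x permutes {1..Suc n}"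
proof (rule permutesI_inj)
  show "inj_on (append_value n p x) {1..Suc n}"
  proof (rule inj_onI)
    fix i j assume *: "i \<in> {1..Suc n}" "j \<in> {1..Suc n}" "append_value n p x i = append_value n p x j"
    show "i = j"
      using * permutes_eq_iff[OF assms(1), of i j]
      by (auto simp: append_value_def le_Suc_eq split: if_splits)
  qed
  show "append_value n p x ` {1..Suc n} \<subseteq> {1..Suc n}"
  proof clarify
    fix i assume "i \<in> {1..Suc n}"
    then show "append_value n p x i \<in> {1..Suc n}"
      using assms permutes_interval[OF assms(1), of i] by (auto simp: append_value_def)
  qed
qed (auto simp: append_value_def)

lemma delete_last_permutes:
  assumes "q permutes {1..Suc n}"
  shows "delete_last n q permutes {1..n}"
proof (rule permutesI_inj)
  have ne: "q i \<noteq> q (Suc n)" if "i \<le> n" for i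
    using that permutes_eq_iff[OF assms, of i "Suc n"] by simp
  show "inj_on (delete_last n q) {1..n}"
  proof (rule inj_onI)
    fix i j assume *: "i \<in> {1..n}" "j \<in> {1..n}" "delete_last n q i = delete_last n q j"
    then have "q i = q j"
      using ne[of i] ne[of j] by (auto simp: delete_last_def split: if_splits)
    then show "i = j" using permutes_eq_iff[OF assms] by simp
  qed
  show "delete_last n q ` {1..n} \<subseteq> {1..n}"
  proof clarify
    fix i assume "i \<in> {1..n}"
    then show "delete_last n q i \<in> {1..n}"
      using ne[of i] permutes_interval[OF assms, of i] permutes_interval[OF assms, of "Suc n"]
      by (auto simp: delete_last_def)
  qed
qed (auto simp: delete_last_def)

lemma delete_last_append_value:
  assumes "p permutes {1..n}"
  shows "delete_last n (append_value n p x) = p"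
proof
  fix i
  show "delete_last n (append_value n p x) i = p i"
    using permutes_not_in[OF assms, of i]
    by (auto simp: delete_last_def append_value_def)
qed

lemma append_value_delete_last:
  assumes "q permutes {1..Suc n}"
  shows "append_value n (delete_last n q) (q (Suc n)) = q"
proof
  fix i
  show "append_value n (delete_last n q) (q (Suc n)) i = q i"
    using permutes_not_in[OF assms, of i] permutes_eq_iff[OF assms, of i "Suc n"]
    by (auto simp: delete_last_def append_value_def)
qed

lemma perms_child_bij:
  "bij_betw (\<lambda>(p, x). append_value n p x) (SIGMA p:perms n. perm_sites n p) (perms (Suc n))"
proof (rule bij_betw_byWitness[where f' = "\<lambda>q. (delete_last n q, q (Suc n))"])
  show "\<forall>a\<in>SIGMA p:perms n. perm_sites n p. (delete_last n ((\<lambda>(p, x). append_value n p x) a),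
      (\<lambda>(p, x). append_value n p x) a (Suc n)) = a"
    by (clarsimp simp: mem_perms delete_last_append_value)
  show "\<forall>q\<in>perms (Suc n). (\<lambda>(p, x). append_value n p x) (delete_last n q, q (Suc n)) = q"
    by (clarsimp simp: mem_perms append_value_delete_last)
  show "(\<lambda>(p, x). append_value n p x) ` (SIGMA p:perms n. perm_sites n p) \<subseteq> perms (Suc n)"
    by (clarsimp simp: mem_perms perm_clean_append_value perm_sites_def append_value_permutes[simplified])
  show "(\<lambda>q. (delete_last n q, q (Suc n))) ` perms (Suc n) \<subseteq> (SIGMA p:perms n. perm_sites n p)"
  proof clarify
    fix q assume q: "q \<in> perms (Suc n)"
    then have p: "q permutes {1..Suc n}" by (simp only: mem_perms)
    have "perm_clean n (delete_last n q) \<and> perm_site n (delete_last n q) (q (Suc n))"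
      using q by (simp only: mem_perms append_value_delete_last flip: perm_clean_append_value)
    then show "delete_last n q \<in> perms n \<and> q (Suc n) \<in> perm_sites n (delete_last n q)"
      using delete_last_permutes[OF p] permutes_interval[OF p, of "Suc n"]
      by (simp add: mem_perms perm_sites_def)
  qed
qed

text \<open>Triples of old positions compare with \<open>y\<close> as they did before the shift,
  once \<open>y\<close> is lowered by one if it exceeds \<open>x\<close>. The second conjunct
  collects the triples ending at the new position; there \<open>Suc (p i)\<close> is the raised
  value.\<close>

lemma perm_site_append_value:
  "perm_site (Suc n) (append_value n p x) y \<longleftrightarrow>
     perm_site n p (if y \<le> x then y else y - 1) \<and>
     (\<forall>i j. 1 \<le> i \<longrightarrow> i < j \<longrightarrow> j \<le> n \<longrightarrow>
        \<not> (p j < y \<and> y \<le> p i \<and> p i < x) \<and> \<not> (p j < x \<and> x \<le> p i \<and> Suc (p i) < y))"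
  (is "_ \<longleftrightarrow> perm_site n p ?y \<and> _")
proof -
  let ?q = "append_value n p x"
  have cmp: "?q i < y \<longleftrightarrow> p i < ?y" "y \<le> ?q i \<longleftrightarrow> ?y \<le> p i" if "1 \<le> i" "i \<le> n" for i
    using that by (auto simp: append_value_le)
  have old: "(\<not> (?q j < y \<and> y \<le> ?q i \<and> ?q i < ?q k) \<and> \<not> (?q j < ?q k \<and> ?q k < ?q i \<and> ?q i < y)) \<longleftrightarrow>
      (\<not> (p j < ?y \<and> ?y \<le> p i \<and> p i < p k) \<and> \<not> (p j < p k \<and> p k < p i \<and> p i < ?y))"
    if "1 \<le> i" "i < j" "j < k" "k \<le> n" for i j k
    using that by (simp only: append_value_less_iff cmp)
  have new: "(\<not> (?q j < y \<and> y \<le> ?q i \<and> ?q i < x) \<and> \<not> (?q j < x \<and> x < ?q i \<and> ?q i < y)) \<longleftrightarrow>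
      (\<not> (p j < y \<and> y \<le> p i \<and> p i < x) \<and> \<not> (p j < x \<and> x \<le> p i \<and> Suc (p i) < y))"
    if "1 \<le> i" "i < j" "j \<le> n" for i j
    using that by (auto simp: append_value_le)
  have split: "(\<forall>i j k. 1 \<le> i \<longrightarrow> i < j \<longrightarrow> j < k \<longrightarrow> k \<le> Suc n \<longrightarrow> P i j k) \<longleftrightarrow>
      (\<forall>i j k. 1 \<le> i \<longrightarrow> i < j \<longrightarrow> j < k \<longrightarrow> k \<le> n \<longrightarrow> P i j k) \<and>
      (\<forall>i j. 1 \<le> i \<longrightarrow> i < j \<longrightarrow> j \<le> n \<longrightarrow> P i j (Suc n))" (is "?l \<longleftrightarrow> ?r")
    for P :: "nat \<Rightarrow> nat \<Rightarrow> nat \<Rightarrow> bool"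
  proof
    assume l: ?l
    show ?r
      by (intro conjI allI impI l[rule_format]) auto
  qed (auto simp: le_Suc_eq)
  show ?thesis
    unfolding perm_site_def split append_value_last
    by (intro arg_cong2[where f = "(\<and>)"] all_cong1 imp_cong refl old new)
qed

section \<open>Sites after an insertion and sites linked to the final descending run\<close>

lemma perm_siteD:
  assumes "perm_site n p x" "1 \<le> i" "i < j" "j < k" "k \<le> n"
  shows "p j < x \<Longrightarrow> x \<le> p i \<Longrightarrow> p i < p k \<Longrightarrow> False" "p j < p k \<Longrightarrow> p k < p i \<Longrightarrow> p i < x \<Longrightarrow> False"
  using assms unfolding perm_site_def by blast+

text \<open>Since \<open>x \<le> p n\<close>, an obstruction using the new last entry can be traded
  for one using position \<open>n\<close>, so only the old conditions remain. The site
  \<open>x\<close> itself splits into \<open>x\<close> and \<open>Suc x\<close>.\<close>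

lemma perm_sites_down:
  assumes "n \<ge> 1" "p \<in> perms n" "x \<in> perm_downs n p"
  shows "perm_sites (Suc n) (append_value n p x) =
    {y \<in> perm_sites n p. y \<le> x} \<union> Suc ` {y \<in> perm_sites n p. x \<le> y}"
proof -
  have p: "p permutes {1..n}" using assms by (simp add: mem_perms)
  have x: "perm_site n p x" "1 \<le> x" "x \<le> p n" "x \<le> n"
    using assms permutes_interval[OF p, of n] by (auto simp: perm_downs_def perm_sites_def)
  have "perm_site (Suc n) (append_value n p x) y \<longleftrightarrow> perm_site n p (if y \<le> x then y else y - 1)" for y
  proof -
    have "\<not> (p j < y \<and> y \<le> p i \<and> p i < x) \<and> \<not> (p j < x \<and> x \<le> p i \<and> Suc (p i) < y)"
      if y: "perm_site n p (if y \<le> x then y else y - 1)" and ij: "1 \<le> i" "i < j" "j \<le> n" for i j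
    proof (intro conjI notI)
      assume *: "p j < y \<and> y \<le> p i \<and> p i < x"
      then have "j < n" using ij x by (metis le_less_trans less_le_not_le nat_less_le)
      with * ij x y show False
        using perm_siteD(1)[of n p y i j n] by auto
    next
      assume *: "p j < x \<and> x \<le> p i \<and> Suc (p i) < y"
      then have j: "j < n" using ij x by (metis leD nat_less_le)
      then have "p i \<noteq> p n" using ij permutes_eq_iff[OF p] by simp
      \<comment> \<open>With third position \<open>n\<close>, the first case contradicts the site
        condition for \<open>y - 1\<close>, the second that for \<open>x\<close>.\<close>
      then consider "p n < p i" | "p i < p n" by linarith
      then show False
      proof cases
        case 1
        from * x have "perm_site n p (y - 1)" "p i < y - 1" "p j < p n" using y by auto
        with 1 show False using perm_siteD(2)[of n p "y - 1" i j n] ij j by auto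
      next
        case 2
        then show False using * ij x y j perm_siteD(1)[OF x(1), of i j n] by auto
      qed
    qed
    then show ?thesis unfolding perm_site_append_value by blast
  qed
  note this [simp]
  show ?thesis
  proof (intro set_eqI iffI)
    fix y assume y: "y \<in> perm_sites (Suc n) (append_value n p x)"
    show "y \<in> {y \<in> perm_sites n p. y \<le> x} \<union> Suc ` {y \<in> perm_sites n p. x \<le> y}"
    proof (cases "y \<le> x")
      case True
      with y x show ?thesis by (auto simp: perm_sites_def)
    next
      case False
      with y x have "y = Suc (y - 1)" "y - 1 \<in> {y \<in> perm_sites n p. x \<le> y}"
        by (auto simp: perm_sites_def)
      then show ?thesis by blast
    qed
  next
    fix y assume "y \<in> {y \<in> perm_sites n p. y \<le> x} \<union> Suc ` {y \<in> perm_sites n p. x \<le> y}"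
    then show "y \<in> perm_sites (Suc n) (append_value n p x)"
      by (auto simp: perm_sites_def)
  qed
qed

text \<open>Here \<open>p n < x\<close>. A value strictly between \<open>p n\<close> and
  \<open>x\<close>, or above \<open>Suc x\<close>, is blocked by the inversion of \<open>n\<close>
  with the entry of value \<open>y\<close>, respectively \<open>x\<close>.\<close>

lemma perm_sites_flat:
  assumes "n \<ge> 1" "p \<in> perms n" "x \<in> perm_sites n p - perm_downs n p"
  shows "perm_sites (Suc n) (append_value n p x) = insert x (insert (Suc x) (perm_downs n p))"
proof (intro set_eqI iffI)
  have p: "p permutes {1..n}" using assms by (simp add: mem_perms)
  have x: "perm_site n p x" "p n < x" "1 \<le> x" "x \<le> Suc n"
    using assms by (auto simp: perm_downs_def perm_sites_def)
  have pn: "1 \<le> p n" "p n \<le> n" using permutes_interval[OF p, of n] assms(1) by auto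
  fix y
  {
    assume "y \<in> perm_sites (Suc n) (append_value n p x)"
    then have site: "perm_site n p (if y \<le> x then y else y - 1)"
      and new: "\<And>i j. 1 \<le> i \<Longrightarrow> i < j \<Longrightarrow> j \<le> n \<Longrightarrow>
        \<not> (p j < y \<and> y \<le> p i \<and> p i < x) \<and> \<not> (p j < x \<and> x \<le> p i \<and> Suc (p i) < y)"
      and y: "1 \<le> y" "y \<le> Suc (Suc n)"
      unfolding perm_sites_def perm_site_append_value by auto
    consider "y \<le> p n" | "p n < y" "y < x" | "y = x" | "y = Suc x" | "Suc x < y" by linarith
    then show "y \<in> insert x (insert (Suc x) (perm_downs n p))"
    proof cases
      case 1
      with site y x pn show ?thesis by (auto simp: perm_downs_def perm_sites_def)
    next
      case 2
      with y x obtain i where i: "1 \<le> i" "i \<le> n" "p i = y"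
        using permutes_value[OF p, of y] by auto
      with 2 have "i < n" by (metis nat_less_le)
      then have False using new[of i n] i 2 assms(1) by auto
      then show ?thesis ..
    next
      case 5
      with y x obtain i where i: "1 \<le> i" "i \<le> n" "p i = x"
        using permutes_value[OF p, of x] by auto
      with x have "i < n" by (metis nat_less_le)
      then have False using new[of i n] i 5 x assms(1) by auto
      then show ?thesis ..
    qed auto
  }
  assume "y \<in> insert x (insert (Suc x) (perm_downs n p))"
  then consider "y = x" | "y = Suc x" | "y \<in> perm_downs n p" by auto
  then show "y \<in> perm_sites (Suc n) (append_value n p x)"
  proof cases
    case 1
    then show ?thesis using x by (auto simp: perm_sites_def perm_site_append_value)
  next
    case 2
    then show ?thesis using x by (auto simp: perm_sites_def perm_site_append_value)
  next
    case 3
    then have y: "perm_site n p y" "1 \<le> y" "y \<le> p n"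
      by (auto simp: perm_downs_def perm_sites_def)
    have "\<not> (p j < y \<and> y \<le> p i \<and> p i < x) \<and> \<not> (p j < x \<and> x \<le> p i \<and> Suc (p i) < y)"
      if ij: "1 \<le> i" "i < j" "j \<le> n" for i j
    proof (intro conjI notI)
      assume *: "p j < y \<and> y \<le> p i \<and> p i < x"
      then have j: "j < n" using ij y by (metis leD nat_less_le)
      then have "p i \<noteq> p n" using ij permutes_eq_iff[OF p] by simp
      then consider "p n < p i" | "p i < p n" by linarith
      then show False
      proof cases
        case 1
        then show False using * ij y j perm_siteD(2)[OF x(1), of i j n] by auto
      next
        case 2
        then show False using * ij y j perm_siteD(1)[OF y(1), of i j n] by auto
      qed
    qed (use x y in auto)
    with y x pn show ?thesis by (auto simp: perm_sites_def perm_site_append_value)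
  qed
qed

lemma run_DES_less:
  assumes "i \<in> run n (DES n p)" "i < k" "k \<le> n"
  shows "p k < p i"
proof -
  have "Suc i \<le> k" using assms by simp
  then show ?thesis using assms(3)
  proof (induction k rule: dec_induct)
    case base
    then have "i \<in> DES n p" using assms(1) by (auto simp: run_def)
    then show ?case by (simp add: DES_def)
  next
    case (step k)
    then have "k \<in> DES n p" using assms(1) by (auto simp: run_def)
    with step show ?case by (auto simp: DES_def)
  qed
qed

text \<open>The appended value is a close copy of \<open>p i\<close>, just above it. An obstructing
  inversion must lie to the left of \<open>i\<close>, since the entries from \<open>i\<close> on
  descend; then \<open>p i\<close> replaces the copy and completes a forbidden pattern in
  \<open>p\<close>.\<close>

lemma perm_sites_run:
  assumes "p \<in> perms n" "i \<in> run n (DES n p)"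
  shows "Suc (p i) \<in> perm_sites n p - perm_downs n p"
proof -
  have p: "p permutes {1..n}" and clean: "perm_clean n p" using assms by (auto simp: mem_perms)
  note i = run_le[OF assms(2)]
  note less = run_DES_less[OF assms(2)]
  have bad: False if "1 \<le> a" "a < b" "b < c" "b < d" "c \<le> n" "d \<le> n" "p b < p c" "p c < p a" "p a < p d" for a b c d
    using clean that unfolding perm_clean_def by blast
  have "perm_site n p (Suc (p i))"
    unfolding perm_site_def
  proof (intro allI impI conjI notI)
    fix a b c
    assume abc: "1 \<le> a" "a < b" "b < c" "c \<le> n" and *: "p b < Suc (p i) \<and> Suc (p i) \<le> p a \<and> p a < p c"
    have ci: "c < i" using less[of c] abc * by (cases c i rule: linorder_cases) auto
    moreover have "p b \<noteq> p i" using ci abc permutes_eq_iff[OF p] by simp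
    ultimately show False using bad[of a b i c] abc * i by auto
  next
    fix a b c
    assume abc: "1 \<le> a" "a < b" "b < c" "c \<le> n" and *: "p b < p c \<and> p c < p a \<and> p a < Suc (p i)"
    have "b \<noteq> i" "c \<noteq> i" using * by auto
    have bi: "b < i"
    proof (rule ccontr)
      assume "\<not> b < i"
      with \<open>b \<noteq> i\<close> have "i < b" by simp
      then have "b \<in> run n (DES n p)" using run_mono[OF assms(2)] abc by auto
      with run_DES_less[of b n p c] abc * show False by auto
    qed
    then have "p a \<noteq> p i" using abc permutes_eq_iff[OF p] by simp
    then show False using bad[of a b c i] bi abc * i by auto
  qed
  moreover have "p n \<le> p i" using less[of n] i by (cases "i = n") auto
  ultimately show ?thesis
    using permutes_interval[OF p, of i] i by (auto simp: perm_sites_def perm_downs_def)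
qed

text \<open>These facts ensure that an unlinked site gains the mark \<open>Suc n\<close> and
  destroys none. If either failed, all entries after \<open>i\<close> would lie below
  \<open>p i\<close>, and the ascent at \<open>m\<close> after \<open>i\<close> would form with
  \<open>i\<close> and \<open>x\<close> an occurrence of 3124.\<close>

lemma perm_sites_free:
  assumes "p \<in> perms n" "x \<in> perm_sites n p" "x \<notin> (\<lambda>i. Suc (p i)) ` run n (DES n p)"
    and i: "1 \<le> i" "i \<le> n" "x = Suc (p i)"
  shows "x \<le> n" "k < i \<Longrightarrow> p k \<noteq> x"
proof -
  have p: "p permutes {1..n}" using assms by (auto simp: mem_perms)
  have site: "perm_site n p x" using assms by (simp add: perm_sites_def)
  have "i \<notin> run n (DES n p)" using assms by auto
  then obtain m where m: "i \<le> m" "m < n" "m \<notin> DES n p"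
    using last_break[OF i(1,2)] by blast
  have asc: "p m < p (Suc m)"
    using m i(1) permutes_eq_iff[OF p, of m "Suc m"] by (auto simp: DES_def)
  show "x \<le> n"
  proof (rule ccontr)
    assume "\<not> x \<le> n"
    then have le: "p l \<le> p i" if "1 \<le> l" "l \<le> n" for l
      using that permutes_interval[OF p, of l] permutes_interval[OF p, of i] i by simp
    have "m \<noteq> i" using asc le[of "Suc m"] m i by auto
    moreover from this have "p (Suc m) < p i"
      using le[of "Suc m"] m i permutes_eq_iff[OF p, of "Suc m" i] by auto
    ultimately show False
      using perm_siteD(2)[OF site, of i m "Suc m"] asc m i by auto
  qed
  assume "k < i"
  show "p k \<noteq> x"
  proof
    assume kx: "p k = x"
    have k1: "1 \<le> k"
      using kx permutes_not_in[OF p, of 0] i by (cases k) auto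
    have ne: "p l \<noteq> x" "p l \<noteq> p i" if "i < l" for l
      using that \<open>k < i\<close> kx permutes_eq_iff[OF p, of l k] permutes_eq_iff[OF p, of l i] by auto
    have below: "p l < p i" if "i < l" "l \<le> n" for l
      using perm_siteD(1)[OF site k1 \<open>k < i\<close> that] ne[OF that(1)] kx i by (cases "p l < p i") auto
    have "m \<noteq> i" using below[of "Suc m"] asc m by auto
    then show False
      using perm_siteD(2)[OF site i(1), of m "Suc m"] asc m below[of "Suc m"] i by auto
  qed
qed

text \<open>Inserting \<open>x\<close> separates the old values \<open>x - 1\<close> and
  \<open>x\<close>, which destroys the mark at the former. The old value \<open>x\<close>, if there
  is one, becomes \<open>x + 1\<close> to the left of the new entry.\<close>

lemma VID_append_value:
  assumes "n \<ge> 1" "p permutes {1..n}" "1 \<le> x" "x \<le> Suc n"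
  shows "VID (Suc n) (append_value n p x) = {i \<in> VID n p. Suc (p i) \<noteq> x} \<union> (if x = Suc n then {} else {Suc n})"
proof -
  let ?q = "append_value n p x"
  have old: "(\<exists>j\<in>{1..<i}. ?q j = ?q i + 1) \<longleftrightarrow> (\<exists>j\<in>{1..<i}. p j = p i + 1) \<and> Suc (p i) \<noteq> x"
    if "2 \<le> i" "i \<le> n" for i
  proof -
    have "?q j = ?q i + 1 \<longleftrightarrow> p j = p i + 1 \<and> Suc (p i) \<noteq> x" if "j \<in> {1..<i}" for j
      using that \<open>i \<le> n\<close> \<open>2 \<le> i\<close> by (auto simp: append_value_le)
    then show ?thesis by auto
  qed
  have new: "(\<exists>j\<in>{1..<Suc n}. ?q j = x + 1) \<longleftrightarrow> x \<noteq> Suc n"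
  proof
    assume "\<exists>j\<in>{1..<Suc n}. ?q j = x + 1"
    then obtain j where "1 \<le> j" "j \<le> n" "?q j = x + 1" by auto
    then show "x \<noteq> Suc n"
      using permutes_interval[OF assms(2), of j] by (auto simp: append_value_le split: if_splits)
  next
    assume "x \<noteq> Suc n"
    then obtain j where "1 \<le> j" "j \<le> n" "p j = x"
      using permutes_value[OF assms(2), of x] assms by auto
    then show "\<exists>j\<in>{1..<Suc n}. ?q j = x + 1"
      by (intro bexI[of _ j]) (auto simp: append_value_le)
  qed
  show ?thesis
  proof (rule set_eqI)
    fix i
    consider "i < 2 \<or> Suc n < i" | "2 \<le> i" "i \<le> n" | "i = Suc n" by linarith
    then show "i \<in> VID (Suc n) ?q \<longleftrightarrow> i \<in> {i \<in> VID n p. Suc (p i) \<noteq> x} \<union> (if x = Suc n then {} else {Suc n})"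
    proof cases
      case 1
      then show ?thesis using assms(1) by (auto simp: VID_def)
    next
      case 2
      then show ?thesis using old[OF 2] by (simp add: VID_def)
    next
      case 3
      then show ?thesis using new assms(1) by (simp add: VID_def)
    qed
  qed
qed

lemma DES_append_value:
  assumes "n \<ge> 1"
  shows "DES (Suc n) (append_value n p x) = DES n p \<union> (if x \<le> p n then {n} else {})"
proof (rule set_eqI)
  fix i
  consider "i = 0 \<or> n < i" | "1 \<le> i" "i < n" | "i = n" by linarith
  then show "i \<in> DES (Suc n) (append_value n p x) \<longleftrightarrow> i \<in> DES n p \<union> (if x \<le> p n then {n} else {})"
  proof cases
    case 1
    then show ?thesis using assms by (auto simp: DES_def)
  next
    case 2
    then have "i \<le> n - 1" by simp
    with 2 show ?thesis by (simp add: DES_def append_value_less_iff)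
  next
    case 3
    moreover have "n \<notin> DES n p" using assms by (auto simp: DES_def)
    ultimately show ?thesis using assms by (simp add: DES_def append_value_vs_last)
  qed
qed

lemma finite_perm_sites: "finite (perm_sites n p)"
  by (simp add: perm_sites_def)

lemma finite_perm_downs: "finite (perm_downs n p)"
  by (simp add: perm_downs_def finite_perm_sites)

interpretation perm_tree: run_tree perms perm_sites perm_downs append_value "\<lambda>p i. Suc (p i)" VID DES
proof (unfold_locales, goal_cases)
  case 1
  have "perm_clean 1 p" for p by (simp add: perm_clean_def)
  then have "perms 1 = {id}"
    by (simp only: set_eq_iff mem_perms) (simp add: permutes_sing)
  moreover have "perm_site 1 id x" for x
    by (simp add: perm_site_def)
  then have s: "perm_sites 1 id = {1, 2}"
    by (auto simp: perm_sites_def)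
  moreover have "perm_downs 1 id = {1}"
    unfolding perm_downs_def s by auto
  ultimately show ?case
    by (intro exI[of _ id]) (auto simp: VID_def DES_def)
next
  case (2 n)
  show ?case by (rule perms_child_bij)
next
  case (3 n p)
  show ?case by (rule finite_perm_sites)
next
  case (4 n p)
  show ?case by (auto simp: perm_downs_def)
next
  case (5 n p)
  then have "p permutes {1..n}" by (simp add: mem_perms)
  then show ?case by (intro inj_onI) (simp add: permutes_eq_iff)
next
  case (6 n p i)
  show ?case by (rule perm_sites_run[OF 6(2,3)])
next
  case (7 n p x)
  then show ?case unfolding DES_append_value[OF 7(1)] by (simp add: perm_downs_def)
next
  case (8 n p x)
  then show ?case unfolding DES_append_value[OF 8(1)] by (simp add: perm_downs_def)
next
  case (9 n p x)
  then have p: "p permutes {1..n}" by (simp add: mem_perms)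
  have x: "1 \<le> x" "x \<le> Suc n" using 9 by (auto simp: perm_sites_def)
  have free: "x \<le> n" "k < i \<Longrightarrow> p k \<noteq> x" if "1 \<le> i" "i \<le> n" "x = Suc (p i)" for i k
    using perm_sites_free[OF 9(2) _ _ that] 9(3) by auto
  \<comment> \<open>The value \<open>n + 1\<close> is the successor of the largest entry, so the
    first part of \<open>perm_sites_free\<close> excludes it.\<close>
  have "x \<le> n"
  proof (rule ccontr)
    assume "\<not> x \<le> n"
    then obtain i where "1 \<le> i" "i \<le> n" "p i = n" 
      using permutes_value[OF p, of n] 9(1) by auto
    then show False using free(1)[of i] x \<open>\<not> x \<le> n\<close> by auto
  qed
  moreover have "{i \<in> VID n p. Suc (p i) \<noteq> x} = VID n p"
    using free(2) by (fastforce simp: VID_def)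
  ultimately show ?case unfolding VID_append_value[OF 9(1) p x] by auto
next
  case (10 n p i)
  then have p: "p permutes {1..n}" by (simp add: mem_perms)
  note i = run_le[OF 10(3)]
  have x: "1 \<le> Suc (p i)" "Suc (p i) \<le> Suc n" using permutes_interval[OF p, of i] i by auto
  \<comment> \<open>Everything after a run position is smaller, so the value \<open>p i + 1\<close>
    can only be on its left; it is missing exactly when \<open>p i = n\<close>.\<close>
  have "i \<in> VID n p \<longleftrightarrow> Suc (p i) \<noteq> Suc n"
  proof
    assume "i \<in> VID n p"
    then obtain j where "1 \<le> j" "j < i" "p j = Suc (p i)" by (auto simp: VID_def)
    then show "Suc (p i) \<noteq> Suc n" using permutes_interval[OF p, of j] i by auto
  next
    assume "Suc (p i) \<noteq> Suc n"
    then obtain j where j: "1 \<le> j" "j \<le> n" "p j = Suc (p i)"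
      using permutes_value[OF p, of "Suc (p i)"] x by auto
    then have "j < i"
      using run_DES_less[OF 10(3), of j] by (cases j i rule: linorder_cases) auto
    with j i show "i \<in> VID n p" by (force simp: VID_def)
  qed
  moreover have "{k \<in> VID n p. Suc (p k) \<noteq> Suc (p i)} = VID n p - {i}"
    using permutes_eq_iff[OF p] by auto
  ultimately show ?case
    unfolding VID_append_value[OF 10(1) p x] by (auto simp: move_mark_def)
next
  case (11 n p x)
  let ?A = "{y \<in> perm_sites n p. y \<le> x}" and ?B = "{y \<in> perm_sites n p. x \<le> y}"
  have x: "x \<in> perm_sites n p" using 11 by (simp add: perm_downs_def)
  have "card (perm_sites (Suc n) (append_value n p x)) = card (?A \<union> Suc ` ?B)"
    by (simp add: perm_sites_down[OF 11])
  also have "\<dots> = card ?A + card (Suc ` ?B)"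
    using finite_perm_sites by (intro card_Un_disjoint) auto
  also have "card (Suc ` ?B) = card ?B" by (simp add: card_image)
  \<comment> \<open>The overlap \<open>{x}\<close> is counted twice, which is the one additional
    site.\<close>
  also have "card ?A + card ?B = card (?A \<union> ?B) + card (?A \<inter> ?B)"
    using finite_perm_sites by (intro card_Un_Int) auto
  also have "?A \<union> ?B = perm_sites n p" by auto
  also have "?A \<inter> ?B = {x}" using x by auto
  finally show ?case by simp
next
  case (12 n p x)
  then have "x \<notin> perm_downs n p" "Suc x \<notin> perm_downs n p"
    by (auto simp: perm_downs_def)
  then show ?case
    unfolding perm_sites_flat[OF 12] by (simp add: finite_perm_downs)
next
  case (13 n p)
  have "bij_betw (\<lambda>x. card {y \<in> perm_downs n p. y \<le> x}) (perm_downs n p) {1..card (perm_downs n p)}"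
  proof (rule bij_betw_card_chain[OF finite_perm_downs])
    fix c d assume cd: "c \<in> perm_downs n p" "d \<in> perm_downs n p" "c \<noteq> d"
    have "{y \<in> perm_downs n p. y \<le> a} \<subset> {y \<in> perm_downs n p. y \<le> b}" if "b \<in> perm_downs n p" "a < b" for a b
      using that by (intro psubsetI) (auto simp: set_eq_iff not_le[symmetric])
    with cd show "{y \<in> perm_downs n p. y \<le> c} \<subset> {y \<in> perm_downs n p. y \<le> d} \<or>
        {y \<in> perm_downs n p. y \<le> d} \<subset> {y \<in> perm_downs n p. y \<le> c}"
      by (meson linorder_neqE_nat)
  qed auto
  moreover have "perm_downs (Suc n) (append_value n p x) = {y \<in> perm_downs n p. y \<le> x}"
    if "x \<in> perm_downs n p" for x
    using that unfolding perm_downs_def[of "Suc n"] perm_sites_down[OF 13 that]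
    by (auto simp: perm_downs_def)
  then have "bij_betw (\<lambda>x. card (perm_downs (Suc n) (append_value n p x))) (perm_downs n p) B \<longleftrightarrow>
      bij_betw (\<lambda>x. card {y \<in> perm_downs n p. y \<le> x}) (perm_downs n p) B" for B
    by (intro bij_betw_cong) simp
  ultimately show ?case by simp
next
  case (14 n p x)
  then have x: "p n < x" "x \<notin> perm_downs n p" by (auto simp: perm_downs_def)
  \<comment> \<open>Of the two copies of the site, \<open>x\<close> is weakly below the new last
    value and \<open>Suc x\<close> is above it.\<close>
  have "perm_downs (Suc n) (append_value n p x) = insert x (perm_downs n p)"
    using x unfolding perm_downs_def[of "Suc n"] perm_sites_flat[OF 14]
    by (auto simp: perm_downs_def)
  then show ?case using x by (simp add: finite_perm_downs)
qed

theorem theorem3p7: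
  fixes n :: nat and s t :: "nat \<Rightarrow> 'a::comm_semiring_1"
  assumes "n \<ge> 1"
  shows "(\<Sum>p\<in>avoiding_perms n {[3,1,4,2], [3,1,2,4]}. (\<Prod>i\<in>VID n p. s i) * (\<Prod>i\<in>DES n p. t i))
       = (\<Sum>e\<in>inv_seqs_avoiding n (\<ge>) (\<noteq>) (\<ge>). (\<Prod>i\<in>DIST n e. s i) * (\<Prod>i\<in>ASC n e. t i))"
proof -
  obtain m where n: "n = Suc m" using assms by (cases n) auto
  \<comment> \<open>The weight is the monomial of the two statistics; the site counts only drive the
    recursion.\<close>
  let ?F = "\<lambda>V D (a::nat) (u::nat). (\<Prod>i\<in>V. s i) * (\<Prod>i\<in>D. t i)"
  show ?thesis
    unfolding n perms_def[symmetric]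
    using perm_tree.sum_eq_tree_sum[of ?F m] seq_tree.sum_eq_tree_sum[of ?F m] by (simp only:)
qed

end
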